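(* Let $\mathbb{F}$ be a field, $E$ a vector space over $\mathbb{F}$ with a symmetric bilinear form $b\colon E\times E\to\mathbb{F}$, and $\alpha\in\mathbb{F}$ with $\alpha\notin\{0,1\}$ and $\alpha\neq\frac12$ (i.e. $2\alpha\ne1$). Let $A=S(b,\alpha)$ be the split spin factor algebra and $\mathbf{1}=z_1+z_2$ its identity. Then a non-zero idempotent in $A$ is one of $\mathbf{1}$, $z_1$, $z_2$, or is in one of the following two families: (a) $\tfrac12\left(e+\alpha z_1+(\alpha+1)z_2\right)$, (b) $\tfrac12\left(e+(2-\alpha)z_1+(1-\alpha)z_2\right)$, where $e\in E$ is such that $b(e,e)=1$. (The two families require $\mathrm{char}(\mathbb{F})\neq2$; in characteristic $2$ the only non-zero idempotents are $\mathbf{1},z_1,z_2$.)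
   Context: The split spin factor $S(b,\alpha)$ is the commutative (not necessarily associative) algebra on the vector space $E\oplus\mathbb{F}z_1\oplus\mathbb{F}z_2$ with multiplication $z_1^2=z_1$, $z_2^2=z_2$, $z_1z_2=0$, $ez_1=\alpha e$, $ez_2=(1-\alpha)e$, $ef=-b(e,f)z$ for all $e,f\in E$, where $z:=\alpha(\alpha-2)z_1+(\alpha-1)(\alpha+1)z_2$. *)

theory Defs
  imports "HOL-Library.Product_Plus" "HOL-Computational_Algebra.Computational_Algebra"
begin

definition symmetric_bilinear_form ::
    "('f::field \<Rightarrow> 'e::ab_group_add \<Rightarrow> 'e) \<Rightarrow> ('e \<Rightarrow> 'e \<Rightarrow> 'f) \<Rightarrow> bool" where
  "symmetric_bilinear_form scale b \<longleftrightarrow>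
     (\<forall>u. Vector_Spaces.linear scale (*) (\<lambda>v. b u v)) \<and>
     (\<forall>v. Vector_Spaces.linear scale (*) (\<lambda>u. b u v)) \<and>
     (\<forall>u v. b u v = b v u)"

text \<open>
  The triple \<open>(e, s, t)\<close> stands for the element \<open>e + s z\<^sub>1 + t z\<^sub>2\<close> of the direct sum
  of \<open>E\<close> (the whole type \<open>'e\<close>), \<open>F z\<^sub>1\<close> and \<open>F z\<^sub>2\<close>. Zero and addition are the
  componentwise ones of the library.
\<close>

type_synonym ('e, 'f) ssf = "'e \<times> 'f \<times> 'f"

definition ssf_scale ::
    "('f::field \<Rightarrow> 'e::ab_group_add \<Rightarrow> 'e) \<Rightarrow> 'f \<Rightarrow> ('e, 'f) ssf \<Rightarrow> ('e, 'f) ssf" where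
  "ssf_scale scale c x = (case x of (e, s, t) \<Rightarrow> (scale c e, c * s, c * t))"

definition ssf_emb :: "'e \<Rightarrow> ('e::ab_group_add, 'f::field) ssf" where
  "ssf_emb e = (e, 0, 0)"

definition ssf_z1 :: "('e::ab_group_add, 'f::field) ssf" where
  "ssf_z1 = (0, 1, 0)"

definition ssf_z2 :: "('e::ab_group_add, 'f::field) ssf" where
  "ssf_z2 = (0, 0, 1)"

definition ssf_one :: "('e::ab_group_add, 'f::field) ssf" where
  "ssf_one = ssf_z1 + ssf_z2"

definition ssf_z ::
    "('f::field \<Rightarrow> 'e::ab_group_add \<Rightarrow> 'e) \<Rightarrow> 'f \<Rightarrow> ('e, 'f) ssf" where
  "ssf_z scale \<alpha> =
     ssf_scale scale (\<alpha> * (\<alpha> - 2)) ssf_z1 + ssf_scale scale ((\<alpha> - 1) * (\<alpha> + 1)) ssf_z2"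

text \<open>
  The product of \<open>e + s z\<^sub>1 + t z\<^sub>2\<close> and \<open>f + s' z\<^sub>1 + t' z\<^sub>2\<close>, obtained by expanding
  bilinearly and commutatively from the products of \<open>e, f, z\<^sub>1, z\<^sub>2\<close>. The lemmas below
  show that it is the only bilinear commutative product with the defining multiplication table.
\<close>

definition ssf_mult ::
    "('f::field \<Rightarrow> 'e::ab_group_add \<Rightarrow> 'e) \<Rightarrow> ('e \<Rightarrow> 'e \<Rightarrow> 'f) \<Rightarrow> 'f
      \<Rightarrow> ('e, 'f) ssf \<Rightarrow> ('e, 'f) ssf \<Rightarrow> ('e, 'f) ssf" where
  "ssf_mult scale b \<alpha> x y =
     (case x of (e, s, t) \<Rightarrow> case y of (f, s', t') \<Rightarrow>
        ssf_emb (scale (s' * \<alpha> + t' * (1 - \<alpha>)) e + scale (s * \<alpha> + t * (1 - \<alpha>)) f)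
      + ssf_scale scale (s * s') ssf_z1 + ssf_scale scale (t * t') ssf_z2
      + ssf_scale scale (- b e f) (ssf_z scale \<alpha>))"

definition ssf_idempotent ::
    "('f::field \<Rightarrow> 'e::ab_group_add \<Rightarrow> 'e) \<Rightarrow> ('e \<Rightarrow> 'e \<Rightarrow> 'f) \<Rightarrow> 'f \<Rightarrow> ('e, 'f) ssf \<Rightarrow> bool" where
  "ssf_idempotent scale b \<alpha> x \<longleftrightarrow> ssf_mult scale b \<alpha> x x = x"

text \<open>
  The two families are meaningful only in characteristic other than 2: otherwise \<open>1/2\<close> is
  \<open>0\<close> by the division convention.
\<close>

definition ssf_family_a ::
    "('f::field \<Rightarrow> 'e::ab_group_add \<Rightarrow> 'e) \<Rightarrow> ('e \<Rightarrow> 'e \<Rightarrow> 'f) \<Rightarrow> 'f \<Rightarrow> ('e, 'f) ssf set" where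
  "ssf_family_a scale b \<alpha> =
     {ssf_scale scale (1/2) (ssf_emb e + ssf_scale scale \<alpha> ssf_z1 + ssf_scale scale (\<alpha> + 1) ssf_z2)
      | e. b e e = 1}"

definition ssf_family_b ::
    "('f::field \<Rightarrow> 'e::ab_group_add \<Rightarrow> 'e) \<Rightarrow> ('e \<Rightarrow> 'e \<Rightarrow> 'f) \<Rightarrow> 'f \<Rightarrow> ('e, 'f) ssf set" where
  "ssf_family_b scale b \<alpha> =
     {ssf_scale scale (1/2) (ssf_emb e + ssf_scale scale (2 - \<alpha>) ssf_z1 + ssf_scale scale (1 - \<alpha>) ssf_z2)
      | e. b e e = 1}"

lemmas ssf_defs = ssf_mult_def ssf_scale_def ssf_emb_def ssf_z1_def ssf_z2_def ssf_z_def
  ssf_one_def zero_prod_def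

context
  fixes scale :: "'f::field \<Rightarrow> 'e::ab_group_add \<Rightarrow> 'e" and b :: "'e \<Rightarrow> 'e \<Rightarrow> 'f" and \<alpha> :: 'f
  assumes vs: "vector_space scale" and sb: "symmetric_bilinear_form scale b"
begin

interpretation vector_space scale by (rule vs)

lemma b_simps:
  "b (u + v) w = b u w + b v w" "b u (v + w) = b u v + b u w"
  "b (scale c u) v = c * b u v" "b u (scale c v) = c * b u v"
  "b 0 v = 0" "b u 0 = 0"
proof -
  have l: "module_hom scale (*) (\<lambda>v. b u v)" "module_hom scale (*) (\<lambda>u. b u v)" for u v
    using sb unfolding symmetric_bilinear_form_def by (auto dest: Vector_Spaces.linear.axioms(3))
  show "b (u + v) w = b u w + b v w" "b u (v + w) = b u v + b u w"
    by (rule module_hom.add[OF l(2)], rule module_hom.add[OF l(1)])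
  show "b (scale c u) v = c * b u v" "b u (scale c v) = c * b u v"
    by (rule module_hom.scale[OF l(2)], rule module_hom.scale[OF l(1)])
  show "b 0 v = 0" "b u 0 = 0"
    by (rule module_hom.zero[OF l(2)], rule module_hom.zero[OF l(1)])
qed

lemma b_sym: "b u v = b v u"
  using sb unfolding symmetric_bilinear_form_def by auto

lemma vector_space_ssf: "vector_space (ssf_scale scale)"
  by unfold_locales (auto simp: ssf_defs algebra_simps split: prod.splits)

lemma ssf_decomp:
  "(e, s, t) = ssf_emb e + ssf_scale scale s ssf_z1 + ssf_scale scale t ssf_z2"
  by (simp add: ssf_defs)

lemma ssf_mult_commute: "ssf_mult scale b \<alpha> x y = ssf_mult scale b \<alpha> y x"
  by (cases x; cases y) (simp add: ssf_defs b_sym algebra_simps)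

lemma ssf_mult_add_right:
  "ssf_mult scale b \<alpha> x (y + y') = ssf_mult scale b \<alpha> x y + ssf_mult scale b \<alpha> x y'"
  by (cases x; cases y; cases y') (simp add: ssf_defs b_simps algebra_simps)

lemma ssf_mult_scale_right:
  "ssf_mult scale b \<alpha> x (ssf_scale scale c y) = ssf_scale scale c (ssf_mult scale b \<alpha> x y)"
  by (cases x; cases y) (simp add: ssf_defs b_simps algebra_simps)

lemma ssf_mult_table:
  "ssf_mult scale b \<alpha> ssf_z1 ssf_z1 = ssf_z1"
  "ssf_mult scale b \<alpha> ssf_z2 ssf_z2 = ssf_z2"
  "ssf_mult scale b \<alpha> ssf_z1 ssf_z2 = 0"
  "ssf_mult scale b \<alpha> (ssf_emb e) ssf_z1 = ssf_scale scale \<alpha> (ssf_emb e)"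
  "ssf_mult scale b \<alpha> (ssf_emb e) ssf_z2 = ssf_scale scale (1 - \<alpha>) (ssf_emb e)"
  "ssf_mult scale b \<alpha> (ssf_emb e) (ssf_emb f) = ssf_scale scale (- b e f) (ssf_z scale \<alpha>)"
  by (simp_all add: ssf_defs b_simps)

lemma ssf_mult_one: "ssf_mult scale b \<alpha> ssf_one x = x"
  by (cases x) (simp add: ssf_defs b_simps)

lemma ssf_mult_unique:
  fixes m :: "('e, 'f) ssf \<Rightarrow> ('e, 'f) ssf \<Rightarrow> ('e, 'f) ssf"
  assumes comm: "\<And>x y. m x y = m y x"
    and add: "\<And>x y y'. m x (y + y') = m x y + m x y'"
    and scal: "\<And>x c y. m x (ssf_scale scale c y) = ssf_scale scale c (m x y)"
    and table: "m ssf_z1 ssf_z1 = ssf_z1" "m ssf_z2 ssf_z2 = ssf_z2" "m ssf_z1 ssf_z2 = 0"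
      "\<And>e. m (ssf_emb e) ssf_z1 = ssf_scale scale \<alpha> (ssf_emb e)"
      "\<And>e. m (ssf_emb e) ssf_z2 = ssf_scale scale (1 - \<alpha>) (ssf_emb e)"
      "\<And>e f. m (ssf_emb e) (ssf_emb f) = ssf_scale scale (- b e f) (ssf_z scale \<alpha>)"
  shows "m = ssf_mult scale b \<alpha>"
proof (intro ext)
  fix x y :: "('e, 'f) ssf"
  obtain e s t f s' t' where xy: "x = (e, s, t)" "y = (f, s', t')"
    by (metis prod.exhaust)
  have add': "m (u + u') w = m u w + m u' w" for u u' w
    by (metis add comm)
  have scal': "m (ssf_scale scale c u) w = ssf_scale scale c (m u w)" for c u w
    by (metis scal comm)
  have table': "m ssf_z2 ssf_z1 = 0" "m ssf_z1 (ssf_emb e) = ssf_scale scale \<alpha> (ssf_emb e)"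
      "m ssf_z2 (ssf_emb e) = ssf_scale scale (1 - \<alpha>) (ssf_emb e)" for e
    by (metis table comm)+
  show "m x y = ssf_mult scale b \<alpha> x y"
    unfolding xy ssf_decomp[of e s t] ssf_decomp[of f s' t']
    by (simp only: add add' scal scal' table table') (simp add: ssf_defs algebra_simps)
qed

end

end

theory Submission
  imports Defs
begin

text \<open>
  Comparing components, \<open>e + s z\<^sub>1 + t z\<^sub>2\<close> is idempotent iff
  \<open>2 (s \<alpha> + t (1 - \<alpha>)) e = e\<close>, \<open>s\<^sup>2 - s = b(e,e) \<alpha> (\<alpha> - 2)\<close> and
  \<open>t\<^sup>2 - t = b(e,e) (\<alpha>\<^sup>2 - 1)\<close>.  If \<open>e = 0\<close>, this says \<open>s, t \<in> {0, 1}\<close>, which gives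
  \<open>0\<close>, \<open>z\<^sub>1\<close>, \<open>z\<^sub>2\<close> and the identity.  If \<open>e \<noteq> 0\<close>, the first equation becomes
  \<open>2 (s \<alpha> + t (1 - \<alpha>)) = 1\<close>, so the characteristic is not 2.

  In that case put \<open>\<beta> = 4 b(e,e) = b(2e,2e)\<close>.  The linear equation is solved by
  \<open>2 s = 1 + k (\<alpha> - 1)\<close> and \<open>2 t = 1 + k \<alpha>\<close> for a scalar \<open>k\<close>, and the two quadratic equations turn
  into \<open>(k\<^sup>2 - \<beta>) (\<alpha> - 1)\<^sup>2 = 1 - \<beta> = (k\<^sup>2 - \<beta>) \<alpha>\<^sup>2\<close>.  As
  \<open>\<alpha>\<^sup>2 - (\<alpha> - 1)\<^sup>2 = 2 \<alpha> - 1 \<noteq> 0\<close>, it follows that \<open>k\<^sup>2 = \<beta> = 1\<close>.  The signs \<open>k = 1\<close> and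
  \<open>k = -1\<close> give the two families, each with \<open>2 e\<close> as the vector of square length 1.
\<close>

lemma two_eq_0_iff_CHAR: "(2 :: 'a::field) = 0 \<longleftrightarrow> CHAR('a) = 2"
proof
  assume "(2 :: 'a) = 0"
  then have "of_nat 2 = (0 :: 'a)"
    by simp
  then have "CHAR('a) dvd 2"
    by (simp only: of_nat_eq_0_iff_char_dvd)
  moreover have "CHAR('a) \<noteq> 1"
    by simp
  ultimately show "CHAR('a) = 2"
    using prime_nat_iff[of 2] two_is_prime_nat by blast
next
  assume "CHAR('a) = 2"
  then have "of_nat 2 = (0 :: 'a)"
    by (simp only: of_nat_eq_0_iff_char_dvd dvd_refl)
  then show "(2 :: 'a) = 0"
    by simp
qed

lemma square_eq_self_iff: "x * x = x \<longleftrightarrow> x = 0 \<or> x = (1 :: 'a::idom)"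
  by auto

text \<open>
  The scalar equations for \<open>e \<noteq> 0\<close>, with \<open>B\<close> in place of \<open>b(e,e)\<close>, have exactly two solutions
  \<open>(s, t, B)\<close> outside characteristic 2.
\<close>

lemma idempotent_scalar_equations_iff:
  fixes \<alpha> s t B :: "'f::field"
  assumes two: "(2 :: 'f) \<noteq> 0" and \<alpha>0: "\<alpha> \<noteq> 0" and half: "2 * \<alpha> \<noteq> 1"
  shows "2 * (s * \<alpha> + t * (1 - \<alpha>)) = 1 \<and>
         s * s - B * (\<alpha> * (\<alpha> - 2)) = s \<and> t * t - B * ((\<alpha> - 1) * (\<alpha> + 1)) = t \<longleftrightarrow>
         4 * B = 1 \<and> (2 * s = \<alpha> \<and> 2 * t = \<alpha> + 1 \<or> 2 * s = 2 - \<alpha> \<and> 2 * t = 1 - \<alpha>)"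
    (is "?L \<longleftrightarrow> ?R")
proof
  assume ?L
  then have lin: "2 * (s * \<alpha> + t * (1 - \<alpha>)) = 1"
    and q1: "s * s - B * (\<alpha> * (\<alpha> - 2)) = s" and q2: "t * t - B * ((\<alpha> - 1) * (\<alpha> + 1)) = t"
    by auto
  define k where "k = (2 * t - 1) / \<alpha>"
  have t: "2 * t = 1 + k * \<alpha>"
    using \<alpha>0 by (simp add: k_def)
  have "(2 * s) * \<alpha> + (2 * t) * (1 - \<alpha>) = 1"
    using lin by (simp add: algebra_simps)
  then have "\<alpha> * (2 * s) = \<alpha> * (1 + k * (\<alpha> - 1))"
    unfolding t by (simp add: algebra_simps)
  then have s: "2 * s = 1 + k * (\<alpha> - 1)"
    using \<alpha>0 by simp
  have e1: "(k * k - 4 * B) * ((\<alpha> - 1) * (\<alpha> - 1)) = 1 - 4 * B"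
  proof -
    have "B * (\<alpha> * (\<alpha> - 2)) = s * s - s"
      using q1 by (simp add: algebra_simps)
    then have "4 * (B * (\<alpha> * (\<alpha> - 2))) = 4 * (s * s - s)"
      by simp
    also have "\<dots> = (2 * s) * (2 * s) - 2 * (2 * s)"
      by (simp add: algebra_simps)
    finally show ?thesis
      unfolding s by (simp add: algebra_simps)
  qed
  have e2: "(k * k - 4 * B) * (\<alpha> * \<alpha>) = 1 - 4 * B"
  proof -
    have "B * ((\<alpha> - 1) * (\<alpha> + 1)) = t * t - t"
      using q2 by (simp add: algebra_simps)
    then have "4 * (B * ((\<alpha> - 1) * (\<alpha> + 1))) = 4 * (t * t - t)"
      by simp
    also have "\<dots> = (2 * t) * (2 * t) - 2 * (2 * t)"
      by (simp add: algebra_simps)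
    finally show ?thesis
      unfolding t by (simp add: algebra_simps)
  qed
  have "(k * k - 4 * B) * (2 * \<alpha> - 1) =
      (k * k - 4 * B) * (\<alpha> * \<alpha>) - (k * k - 4 * B) * ((\<alpha> - 1) * (\<alpha> - 1))"
    by (simp add: algebra_simps)
  also have "\<dots> = 0"
    unfolding e1 e2 by simp
  finally have "(k * k - 4 * B) * (2 * \<alpha> - 1) = 0" .
  then have kB: "k * k = 4 * B"
    using half by simp
  with e2 have B: "4 * B = 1"
    by simp
  with kB have "k = 1 \<or> k = -1"
    by (simp add: square_eq_1_iff)
  then show ?R
    using B s t by auto
next
  assume R: ?R
  have "(2 :: 'f) * 2 \<noteq> 0"
    using two by (simp only: mult_eq_0_iff simp_thms)
  then have four: "(4 :: 'f) \<noteq> 0"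
    by simp
  have l: "2 * (s * \<alpha> + t * (1 - \<alpha>)) = (2 * s) * \<alpha> + (2 * t) * (1 - \<alpha>)"
    by (simp add: algebra_simps)
  have q: "4 * (x * x - B * c) = (2 * x) * (2 * x) - (4 * B) * c" "4 * x = 2 * (2 * x)" for x c :: 'f
    by (simp_all add: algebra_simps)
  from R have B: "4 * B = 1"
    and st: "2 * s = \<alpha> \<and> 2 * t = \<alpha> + 1 \<or> 2 * s = 2 - \<alpha> \<and> 2 * t = 1 - \<alpha>"
    by auto
  from st have "2 * (s * \<alpha> + t * (1 - \<alpha>)) = 1"
    unfolding l by (elim disjE conjE) (simp_all only:, simp_all add: algebra_simps)
  moreover from st have "4 * (s * s - B * (\<alpha> * (\<alpha> - 2))) = 4 * s"
    unfolding q(1) q(2)[of s] B by (elim disjE conjE) (simp_all only:, simp_all add: algebra_simps)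
  moreover from st have "4 * (t * t - B * ((\<alpha> - 1) * (\<alpha> + 1))) = 4 * t"
    unfolding q(1) q(2)[of t] B by (elim disjE conjE) (simp_all only:, simp_all add: algebra_simps)
  ultimately show ?L
    using four by (simp only: mult_cancel_left simp_thms)
qed

lemma ssf_idempotent_iff:
  fixes scale :: "'f::field \<Rightarrow> 'e::ab_group_add \<Rightarrow> 'e"
  assumes "vector_space scale"
  shows "ssf_idempotent scale b \<alpha> (e, s, t) \<longleftrightarrow>
    (e = 0 \<or> 2 * (s * \<alpha> + t * (1 - \<alpha>)) = 1) \<and>
    s * s - b e e * (\<alpha> * (\<alpha> - 2)) = s \<and> t * t - b e e * ((\<alpha> - 1) * (\<alpha> + 1)) = t"
proof -
  interpret vector_space scale by fact
  have "scale c e + scale c e = e \<longleftrightarrow> e = 0 \<or> 2 * c = 1" for c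
  proof -
    have "scale c e + scale c e = scale (2 * c) e"
      by (simp only: mult_2 scale_left_distrib)
    moreover have "scale (2 * c) e = e \<longleftrightarrow> e = 0 \<or> 2 * c = 1"
      using scale_cancel_right[of "2 * c" e 1] by auto
    ultimately show ?thesis
      by simp
  qed
  then show ?thesis
    by (simp add: ssf_idempotent_def ssf_defs)
qed

text \<open>
  Both families consist of the elements \<open>(f + p z\<^sub>1 + q z\<^sub>2) / 2\<close> with fixed \<open>p\<close>, \<open>q\<close>
  and \<open>b(f,f) = 1\<close>; here \<open>f\<close> is twice the \<open>E\<close>-component, whence the factor 4.
\<close>

lemma halved_ssf_iff:
  fixes scale :: "'f::field \<Rightarrow> 'e::ab_group_add \<Rightarrow> 'e"
  assumes "vector_space scale" and "symmetric_bilinear_form scale b" and two: "(2 :: 'f) \<noteq> 0"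
  shows "(\<exists>f. (e, s, t) = ssf_scale scale (1 / 2)
            (ssf_emb f + ssf_scale scale p ssf_z1 + ssf_scale scale q ssf_z2) \<and> b f f = 1) \<longleftrightarrow>
         4 * b e e = 1 \<and> 2 * s = p \<and> 2 * t = q"
proof -
  interpret vector_space scale by fact
  have e: "e = scale (1 / 2) f \<longleftrightarrow> f = scale 2 e" for f
    using two by auto
  have st: "s = p / 2 \<longleftrightarrow> 2 * s = p" "t = q / 2 \<longleftrightarrow> 2 * t = q"
    using two by (auto simp: field_simps)
  have "b (scale 2 e) (scale 2 e) = 4 * b e e"
    by (simp add: b_simps[OF assms(1,2)])
  then show ?thesis
    using two by (auto simp: ssf_defs e st)
qed

theorem proposition3p4:
  fixes scale :: "'f::field \<Rightarrow> 'e::ab_group_add \<Rightarrow> 'e"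
    and b :: "'e \<Rightarrow> 'e \<Rightarrow> 'f" and \<alpha> :: 'f
  assumes "vector_space scale"
    and "symmetric_bilinear_form scale b"
    and "\<alpha> \<notin> {0, 1}" and "2 * \<alpha> \<noteq> 1"
  shows "{x. x \<noteq> 0 \<and> ssf_idempotent scale b \<alpha> x} =
    {ssf_one, ssf_z1, ssf_z2} \<union>
    (if CHAR('f) \<noteq> 2 then ssf_family_a scale b \<alpha> \<union> ssf_family_b scale b \<alpha> else {})"
proof (rule set_eqI)
  fix x :: "('e, 'f) ssf"
  obtain e s t where x: "x = (e, s, t)"
    by (metis prod.exhaust)
  note b0 = b_simps(5)[OF assms(1,2)]
  define F where "F \<longleftrightarrow> 4 * b e e = 1 \<and>
    (2 * s = \<alpha> \<and> 2 * t = \<alpha> + 1 \<or> 2 * s = 2 - \<alpha> \<and> 2 * t = 1 - \<alpha>)"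
  have unit: "x \<in> {ssf_one, ssf_z1, ssf_z2} \<longleftrightarrow>
      e = 0 \<and> (s = 1 \<and> t = 1 \<or> s = 1 \<and> t = 0 \<or> s = 0 \<and> t = 1)"
    by (auto simp: x ssf_defs)
  have families: "x \<in> ssf_family_a scale b \<alpha> \<union> ssf_family_b scale b \<alpha> \<longleftrightarrow> F"
    if "(2 :: 'f) \<noteq> 0"
    using halved_ssf_iff[OF assms(1,2) that, of e s t]
    by (simp add: x ssf_family_a_def ssf_family_b_def F_def conj_disj_distribL)
  have "x \<noteq> 0 \<and> ssf_idempotent scale b \<alpha> x \<longleftrightarrow>
      x \<in> {ssf_one, ssf_z1, ssf_z2} \<or> (2 :: 'f) \<noteq> 0 \<and> F"
  proof (cases "e = 0")
    case True
    have "ssf_idempotent scale b \<alpha> x \<longleftrightarrow> s * s = s \<and> t * t = t"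
      unfolding x ssf_idempotent_iff[OF assms(1)] True b0 by simp
    then have "ssf_idempotent scale b \<alpha> x \<longleftrightarrow> (s = 0 \<or> s = 1) \<and> (t = 0 \<or> t = 1)"
      unfolding square_eq_self_iff .
    moreover have "x = 0 \<longleftrightarrow> s = 0 \<and> t = 0"
      unfolding x True zero_prod_def by simp
    moreover have "\<not> F"
      unfolding F_def True b0 by simp
    ultimately show ?thesis
      unfolding unit using True by (cases "s = 0"; cases "t = 0"; simp)
  next
    case False
    have "x \<noteq> 0 \<and> ssf_idempotent scale b \<alpha> x \<longleftrightarrow> (2 :: 'f) \<noteq> 0 \<and> F"
    proof (cases "(2 :: 'f) = 0")
      case True
      then show ?thesis
        unfolding x ssf_idempotent_iff[OF assms(1)] using False by simp
    next
      case two: False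
      have "x \<noteq> 0"
        unfolding x zero_prod_def using False by simp
      moreover have "\<alpha> \<noteq> 0"
        using assms(3) by simp
      ultimately show ?thesis
        unfolding F_def idempotent_scalar_equations_iff[OF two \<open>\<alpha> \<noteq> 0\<close> assms(4), symmetric]
        unfolding x ssf_idempotent_iff[OF assms(1)] using False two
        by (simp only: simp_thms)
    qed
    with False show ?thesis
      unfolding unit by simp
  qed
  then show "x \<in> {x. x \<noteq> 0 \<and> ssf_idempotent scale b \<alpha> x} \<longleftrightarrow>
      x \<in> {ssf_one, ssf_z1, ssf_z2} \<union>
      (if CHAR('f) \<noteq> 2 then ssf_family_a scale b \<alpha> \<union> ssf_family_b scale b \<alpha> else {})"
    using families two_eq_0_iff_CHAR[where 'a = 'f] by auto
qed

end
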